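(* For every set $\mathbf{P}$ of predicates on words there is an additively optimal problem complexity $C\{Pr(P(x),M)\}$; that is, there is a Turing machine $M$ such that for every Turing machine $T$ there is a number $k$ such that for every predicate $P(x)\in\mathbf{P}$, $$C\{Pr(P(x),M)\}\le C\{Pr(P(x),T)\}+k .$$
   Context: Words are finite words in a fixed but arbitrary finite alphabet $A$; $A^*$ is the set of all of them, and $l(p)$ is the length of the word $p$. Turing machines take words in $A^*$ as inputs and (possibly) give words in $A^*$ as results; $T(p)$ denotes the result of $T$ on input $p$, when it exists. For a predicate $P(x)$ on words and a Turing machine $T$, the problem $Pr(P(x),T)$ is to compute by $T$ a word $w$ such that $P(w)$ is true, and its problem complexity is $$C\{Pr(P(x),T)\}=\min\{\,l(p) : T(p)=w \text{ and } P(w)\text{ is true}\,\},$$ with the value $\infty$ when $T$ produces no word $w$ for which $P(w)$ is true. Here $\infty$ is larger than any number, and $\infty+k=\infty$.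
   Formalization: The alphabet A is assumed to have at least two letters; over a one-letter alphabet the claim is false, for example for the set of all predicates "x = w", since M has too few short inputs to match the machines a^n -> a^(2n) and a^n -> a^(2n+1). *)

theory Defs
  imports Main "HOL-Library.Extended_Nat" "HOL-Library.Finite_Map"
    "HOL-Library.While_Combinator"
begin

text \<open>
  Deterministic one-tape Turing machines over an input alphabet given by the finite type
  \<open>'a\<close>. The tape may contain, besides the blank and the letters, auxiliary symbols; every
  machine uses only the finitely many states and symbols occurring in its program.
\<close>

datatype 'a symbol = Blank | is_Letter: Letter (letter: 'a) | Aux nat

datatype move = MoveL | Stay | MoveR

text \<open>
  A machine is its program: a finite set of quintuples (state, scanned symbol, new state,
  written symbol, move), at most one for each state and scanned symbol. The initial state
  is \<open>0\<close>, and the machine halts when no quintuple applies.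
\<close>

type_synonym 'a tm = "(nat \<times> 'a symbol, nat \<times> 'a symbol \<times> move) fmap"

text \<open>
  In a configuration \<open>(q, ls, rs)\<close>, the list \<open>rs\<close> is the tape from the scanned cell
  rightwards, and \<open>ls\<close> is the tape to the left of the scanned cell, nearest cell first.
  The tape is infinite in both directions; all cells beyond the two lists are blank.
\<close>

type_synonym 'a config = "nat \<times> 'a symbol list \<times> 'a symbol list"

fun scanned :: "'a symbol list \<Rightarrow> 'a symbol" where
  "scanned [] = Blank"
| "scanned (x # xs) = x"

fun shift :: "move \<Rightarrow> 'a symbol list \<times> 'a symbol list \<Rightarrow> 'a symbol list \<times> 'a symbol list" where
  "shift MoveL (ls, rs) = (tl ls, scanned ls # rs)"
| "shift Stay (ls, rs) = (ls, rs)"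
| "shift MoveR (ls, rs) = (scanned rs # ls, tl rs)"

fun halted :: "'a tm \<Rightarrow> 'a config \<Rightarrow> bool" where
  "halted T (q, ls, rs) \<longleftrightarrow> fmlookup T (q, scanned rs) = None"

fun step :: "'a tm \<Rightarrow> 'a config \<Rightarrow> 'a config" where
  "step T (q, ls, rs) =
    (case fmlookup T (q, scanned rs) of
       None \<Rightarrow> (q, ls, rs)
     | Some (q', x, m) \<Rightarrow> (q', shift m (ls, x # tl rs)))"

definition initial :: "'a list \<Rightarrow> 'a config" where
  "initial p = (0, [], map Letter p)"

text \<open>
  The word on the tape of a halted machine starts at the scanned cell and extends to the
  right as long as there are letters.
\<close>

fun output_word :: "'a config \<Rightarrow> 'a list" where
  "output_word (q, ls, rs) = map letter (takeWhile is_Letter rs)"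

text \<open>\<open>T(p)\<close>; it is \<open>None\<close> if and only if \<open>T\<close> does not halt on \<open>p\<close>.\<close>

definition result :: "'a tm \<Rightarrow> 'a list \<Rightarrow> 'a list option" where
  "result T p = map_option output_word (while_option (\<lambda>c. \<not> halted T c) (step T) (initial p))"

text \<open>
  In \<^typ>\<open>enat\<close>, the infimum of a nonempty set is its minimum, and the infimum of the empty
  set is \<open>\<infinity>\<close>.
\<close>

definition problem_complexity :: "('a list \<Rightarrow> bool) \<Rightarrow> 'a tm \<Rightarrow> enat" where
  "problem_complexity P T = Inf {enat (length p) | p w. result T p = Some w \<and> P w}"

end

theory Submission
  imports Defs "HOL-Library.Countable"
begin

text \<open>
  The universal machine gets the input \<open>p @ c\<close>, where \<open>c\<close> codes the program of \<open>T\<close>. It keeps the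
  tape in the form ``left stack, program, right stack'', with the tops of the stacks at the outer
  ends, so that the stacks can grow and every sweep of the head knows its direction. The left stack
  holds the tape of \<open>T\<close> from the scanned cell rightwards, the right stack the tape to the left of it.
  A letter codes itself and other symbols are coded in unary, as strokes followed by \<open>End None\<close>.
  The state \<open>q\<close> is put as \<open>q * S\<close> further strokes on top of the left stack, \<open>S\<close> being larger than the
  number of strokes of any symbol. Popping these strokes one by one and moving a mark in the
  program to the next segment each time leads to the instructions for the state and the scanned
  symbol, so the program needs no jumps and the machine never compares words.
  Putting the program to the right of \<open>p\<close> makes \<open>p\<close> the initial left stack without any
  preparation. The constant \<open>k\<close> is the length of \<open>c\<close>.
\<close>

section \<open>The universal machine\<close>

datatype 'a datum = Stroke | End "'a option"

text \<open>
  \<open>MoveEnd\<close> takes one datum from the right stack to the left one (\<open>End None\<close>, a blank, if the right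
  stack is empty); \<open>MoveStrokes\<close> takes strokes as long as there are any on top. \<open>Restart\<close> leads back to
  \<open>Begin\<close>, where popping begins: a popped datum \<open>d\<close> moves control to the next \<open>Label d\<close>.
\<close>

datatype 'a ins = Nop | Begin | Label "'a datum" | PushLeft "'a datum" | PushRight "'a datum" | MoveEnd | MoveStrokes | Restart | Stop

text \<open>The flag of \<open>Ins\<close> marks the instruction the machine is working on while the head is elsewhere.\<close>

datatype 'a cell = Blk | Dat "'a datum" | Ins bool "'a ins"

datatype 'a state = Init | Dec nat | Ex | PushL "'a datum" | PushR "'a datum" | BackL | BackR
  | GoEnd | AtEnd | GoStrokes | AtStrokes | Reset | Pop | AtPop | Ret "'a datum" | Find "'a datum" | Fin | Halt

section \<open>Numbering of cells and states\<close>

instance datum :: (countable) countable by countable_datatype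
instance ins :: (countable) countable by countable_datatype
instance cell :: (countable) countable by countable_datatype
instance state :: (countable) countable by countable_datatype

instance datum :: (finite) finite
proof
  have "(UNIV :: 'a datum set) = insert Stroke (range End)"
    by (auto intro: datum.exhaust)
  then show "finite (UNIV :: 'a datum set)"
    by (metis finite finite_imageI finite_insert)
qed

instance ins :: (finite) finite
proof
  have "(UNIV :: 'a ins set) = {Nop, Begin, MoveEnd, MoveStrokes, Restart, Stop} \<union> range Label \<union> range PushLeft \<union> range PushRight" (is "_ = ?S")
  proof -
    have "i \<in> ?S" for i :: "'a ins" by (cases i) auto
    then show ?thesis by blast
  qed
  moreover have "finite ?S" by simp
  ultimately show "finite (UNIV :: 'a ins set)" by metis
qed

instance cell :: (finite) finite
proof
  have "(UNIV :: 'a cell set) = {Blk} \<union> range Dat \<union> range (\<lambda>(b, i). Ins b i)" (is "_ = ?S")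
  proof -
    have "i \<in> ?S" for i :: "'a cell" by (cases i) auto
    then show ?thesis by blast
  qed
  moreover have "finite ?S" by simp
  ultimately show "finite (UNIV :: 'a cell set)" by metis
qed

text \<open>The datum of a letter is the letter itself, so that an input is already a stack and the
  left stack can be read as output. \<open>Dat (End None)\<close> is not a letter and ends the
  output.\<close>

fun cell_symbol :: "'a::countable cell \<Rightarrow> 'a symbol" where
  "cell_symbol Blk = Blank"
| "cell_symbol (Dat (End (Some a))) = Letter a"
| "cell_symbol c = Aux (to_nat c)"

lemma cell_symbol_eq_iff [simp]: "cell_symbol c = cell_symbol d \<longleftrightarrow> c = d"
  by (cases c rule: cell_symbol.cases; cases d rule: cell_symbol.cases) auto

text \<open>\<open>Init\<close> must get \<open>0\<close>, the initial state of every machine;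
  \<open>Suc\<close> keeps \<open>0\<close> free for it.\<close>

definition state_number :: "'a::countable state \<Rightarrow> nat" where
  "state_number s = (if s = Init then 0 else Suc (to_nat s))"

lemma state_number_eq_iff [simp]: "state_number s = state_number t \<longleftrightarrow> s = t"
  by (auto simp: state_number_def)

fun hd0 :: "'a cell list \<Rightarrow> 'a cell" where
  "hd0 [] = Blk"
| "hd0 (c # cs) = c"

lemma scanned_map_cell_symbol: "scanned (map cell_symbol cs) = cell_symbol (hd0 cs)"
  by (cases cs) auto

lemma hd0_replicate [simp]: "hd0 (replicate n Blk) = Blk"
  by (cases n) auto

lemma tl_replicate_Blk [simp]: "tl (replicate n Blk) = replicate (n - 1) Blk"
  by (cases n) auto

section \<open>The transition table and its program\<close>

locale two_letters =
  fixes a0 a1 :: "'a::finite"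
  assumes distinct_letters: "a0 \<noteq> a1"
begin

definition code_bound :: nat where
  "code_bound = Suc (Max (range (to_nat :: 'a ins \<Rightarrow> nat)))"

lemma to_nat_less_code_bound: "to_nat (i :: 'a ins) < code_bound"
  unfolding code_bound_def by (simp add: less_Suc_eq_le)

text \<open>Decoding goes from right to left and ends at the code word of \<open>Begin\<close>, so
  \<open>p\<close> needs no delimiter. After a transfer \<open>MoveStrokes\<close> is executed
  again, as \<open>BackR\<close> stays on it. When \<open>Find Stroke\<close> succeeds, the mark is
  set on the label found, and popping goes on from there.\<close>

fun \<delta> :: "'a state \<Rightarrow> 'a cell \<Rightarrow> ('a state \<times> 'a cell \<times> move) option" where
  "\<delta> Init c = (if c = Blk then Some (Dec 0, Blk, MoveL) else Some (Init, c, MoveR))"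
| "\<delta> (Dec n) c =
    (if n \<ge> code_bound then None
     else if c = Dat (End (Some a1)) then Some (Dec (Suc n), Ins False Nop, MoveL)
     else if c = Dat (End (Some a0)) then
       (if n = to_nat (Begin :: 'a ins) then Some (Pop, Ins True Begin, MoveL)
        else Some (Dec 0, Ins False (from_nat n), MoveL))
     else None)"
| "\<delta> Ex (Ins b i) = (case i of
      Nop \<Rightarrow> Some (Ex, Ins False Nop, MoveR)
    | PushLeft d \<Rightarrow> Some (PushL d, Ins True i, MoveL)
    | PushRight d \<Rightarrow> Some (PushR d, Ins True i, MoveR)
    | MoveEnd \<Rightarrow> Some (GoEnd, Ins True i, MoveR)
    | MoveStrokes \<Rightarrow> Some (GoStrokes, Ins True i, MoveR)
    | Restart \<Rightarrow> Some (Reset, Ins False i, MoveL)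
    | Stop \<Rightarrow> Some (Fin, Ins False i, MoveL)
    | _ \<Rightarrow> None)"
| "\<delta> Ex c = None"
| "\<delta> (PushL d) c = (if c = Blk then Some (BackR, Dat d, MoveR) else Some (PushL d, c, MoveL))"
| "\<delta> (PushR d) c = (if c = Blk then Some (BackL, Dat d, MoveL) else Some (PushR d, c, MoveR))"
| "\<delta> BackR (Ins True i) = (if i = MoveStrokes then Some (Ex, Ins False i, Stay) else Some (Ex, Ins False i, MoveR))"
| "\<delta> BackR c = Some (BackR, c, MoveR)"
| "\<delta> BackL (Ins True i) = Some (Ex, Ins False i, MoveR)"
| "\<delta> BackL c = Some (BackL, c, MoveL)"
| "\<delta> GoEnd c = (if c = Blk then Some (AtEnd, c, MoveL) else Some (GoEnd, c, MoveR))"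
| "\<delta> AtEnd (Dat d) = Some (PushL d, Blk, MoveL)"
| "\<delta> AtEnd c = Some (PushL (End None), c, MoveL)"
| "\<delta> GoStrokes c = (if c = Blk then Some (AtStrokes, c, MoveL) else Some (GoStrokes, c, MoveR))"
| "\<delta> AtStrokes c = (if c = Dat Stroke then Some (PushL Stroke, Blk, MoveL) else Some (BackL, c, Stay))"
| "\<delta> Reset c = (if c = Ins False Begin then Some (Pop, Ins True Begin, MoveL) else Some (Reset, c, MoveL))"
| "\<delta> Pop c = (if c = Blk then Some (AtPop, c, MoveR) else Some (Pop, c, MoveL))"
| "\<delta> AtPop (Dat d) = Some (Ret d, Blk, MoveR)"
| "\<delta> AtPop c = Some (Ret (End None), c, Stay)"
| "\<delta> (Ret d) (Ins True i) = Some (Find d, Ins False i, MoveR)"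
| "\<delta> (Ret d) c = Some (Ret d, c, MoveR)"
| "\<delta> (Find d) c =
    (if c = Ins False (Label d) then
       (if d = Stroke then Some (Pop, Ins True (Label d), MoveL) else Some (Ex, c, MoveR))
     else Some (Find d, c, MoveR))"
| "\<delta> Fin c = (if c = Blk then Some (Halt, c, MoveR) else Some (Fin, c, MoveL))"
| "\<delta> Halt c = None"

text \<open>The type of states is infinite only through \<open>Dec\<close>, and \<open>Dec n\<close>
  has no transitions for \<open>n \<ge> code_bound\<close>.\<close>

lemma finite_live_states: "finite {s. \<exists>c. \<delta> s c \<noteq> None}"
proof (rule finite_subset)
  let ?S = "{Init, Ex, BackL, BackR, GoEnd, AtEnd, GoStrokes, AtStrokes, Reset, Pop, AtPop, Fin}
    \<union> Dec ` {..<code_bound} \<union> range PushL \<union> range PushR \<union> range Ret \<union> range Find :: 'a state set"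
  show "{s. \<exists>c. \<delta> s c \<noteq> None} \<subseteq> ?S"
  proof
    fix s assume "s \<in> {s. \<exists>c. \<delta> s c \<noteq> None}"
    then show "s \<in> ?S" by (cases s) (auto split: if_splits)
  qed
  show "finite ?S" by simp
qed

definition universal_fun :: "nat \<times> 'a symbol \<Rightarrow> (nat \<times> 'a symbol \<times> move) option" where
  "universal_fun k = (if \<exists>(s :: 'a state) c. k = (state_number s, cell_symbol c)
     then (let (s, c) = (THE (s :: 'a state, c). k = (state_number s, cell_symbol c))
           in map_option (\<lambda>(s', c', m). (state_number s', cell_symbol c', m)) (\<delta> s c)) else None)"

definition universal :: "'a tm" where
  "universal = Abs_fmap universal_fun"

lemma universal_fun_eq: "universal_fun (state_number s, cell_symbol c) = map_option (\<lambda>(s', c', m). (state_number s', cell_symbol c', m)) (\<delta> s c)"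
proof -
  have "(THE (s' :: 'a state, c'). (state_number s, cell_symbol c) = (state_number s', cell_symbol c')) = (s, c)"
    by (rule the_equality) auto
  then show ?thesis unfolding universal_fun_def by auto
qed

lemma fmlookup_universal:
  "fmlookup universal (state_number s, cell_symbol c) = map_option (\<lambda>(s', c', m). (state_number s', cell_symbol c', m)) (\<delta> s c)"
proof -
  let ?S = "state_number ` {s. \<exists>c. \<delta> s c \<noteq> None} \<times> range (cell_symbol :: 'a cell \<Rightarrow> _)"
  have "dom universal_fun \<subseteq> ?S"
  proof
    fix k assume k: "k \<in> dom universal_fun"
    then have "\<exists>(s :: 'a state) c. k = (state_number s, cell_symbol c)"
      unfolding universal_fun_def by (auto split: if_splits)
    then obtain s :: "'a state" and c where sc: "k = (state_number s, cell_symbol c)" by blast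
    have "\<delta> s c \<noteq> None" using k unfolding sc domIff universal_fun_eq by simp
    with sc show "k \<in> ?S" by blast
  qed
  moreover have "finite ?S"
    using finite_live_states by simp
  ultimately have "finite (dom universal_fun)" by (rule finite_subset)
  then have "fmlookup universal = universal_fun" unfolding universal_def by (intro Abs_fmap_inverse) simp
  then show ?thesis by (simp add: universal_fun_eq)
qed

section \<open>Computations of the universal machine\<close>

type_synonym 'b conf = "'b state \<times> 'b cell list \<times> 'b cell list"

fun conc :: "'a conf \<Rightarrow> 'a config" where
  "conc (s, ls, rs) = (state_number s, map cell_symbol ls, map cell_symbol rs)"

definition reach :: "'a conf \<Rightarrow> 'a conf \<Rightarrow> bool" where
  "reach c c' \<longleftrightarrow> (\<exists>k. (step universal ^^ k) (conc c) = conc c')"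

lemma reach_refl [simp]: "reach c c"
  unfolding reach_def by (metis funpow_0)

lemma reach_trans [trans]: "reach c c' \<Longrightarrow> reach c' c'' \<Longrightarrow> reach c c''"
  unfolding reach_def by (metis comp_apply funpow_add)

lemma reach_step: "step universal (conc c) = conc c' \<Longrightarrow> reach c c'"
  unfolding reach_def by (intro exI[of _ 1]) simp

text \<open>The head is on the first cell of \<open>ls\<close>.\<close>

definition lft :: "'a state \<Rightarrow> 'a cell list \<Rightarrow> 'a cell list \<Rightarrow> 'a conf" where
  "lft s ls rs = (s, tl ls, hd0 ls # rs)"

lemma reach_left:
  "\<delta> s (hd0 rs) = Some (s', c, MoveL) \<Longrightarrow> reach (s, ls, rs) (lft s' ls (c # tl rs))"
  by (rule reach_step) (auto simp: lft_def scanned_map_cell_symbol fmlookup_universal map_tl)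

lemma reach_right:
  "\<delta> s (hd0 rs) = Some (s', c, MoveR) \<Longrightarrow> reach (s, ls, rs) (s', c # ls, tl rs)"
  by (rule reach_step) (auto simp: scanned_map_cell_symbol fmlookup_universal map_tl)

lemma reach_stay:
  "\<delta> s (hd0 rs) = Some (s', c, Stay) \<Longrightarrow> reach (s, ls, rs) (s', ls, c # tl rs)"
  by (rule reach_step) (auto simp: scanned_map_cell_symbol fmlookup_universal map_tl)

lemma scan_right:
  "(\<And>c. c \<in> set w \<Longrightarrow> \<delta> s c = Some (s, c, MoveR)) \<Longrightarrow> reach (s, ls, w @ rs) (s, rev w @ ls, rs)"
proof (induction w arbitrary: ls)
  case (Cons c w)
  have "reach (s, ls, (c # w) @ rs) (s, c # ls, w @ rs)"
    using reach_right[of s "(c # w) @ rs"] Cons.prems by simp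
  also have "reach \<dots> (s, rev w @ c # ls, rs)" using Cons by simp
  finally show ?case by simp
qed simp

lemma scan_left:
  "(\<And>c. c \<in> set w \<Longrightarrow> \<delta> s c = Some (s, c, MoveL)) \<Longrightarrow> reach (lft s (w @ ls) rs) (lft s ls (rev w @ rs))"
proof (induction w arbitrary: rs)
  case (Cons c w)
  have "reach (lft s ((c # w) @ ls) rs) (lft s (w @ ls) (c # rs))"
    using reach_left[of s "c # rs"] Cons.prems by (simp add: lft_def)
  also have "reach \<dots> (lft s ls (rev w @ c # rs))" using Cons by simp
  finally show ?case by simp
qed simp

section \<open>Stacks and program on the tape\<close>

abbreviation prg :: "'a ins list \<Rightarrow> 'a cell list" where "prg \<equiv> map (Ins False)"
abbreviation blk :: "nat \<Rightarrow> 'a cell list" where "blk n \<equiv> replicate n Blk"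

text \<open>Tape lists start at the head, so \<open>pre\<close> and \<open>L\<close> occur reversed.
  The top of the left stack is the first element of \<open>L\<close>, that of the right stack the
  last element of \<open>R\<close>. Erased data leave explicit blanks at the ends, counted by
  \<open>m\<close> and \<open>n\<close>.\<close>

definition left_tape :: "'a ins list \<Rightarrow> 'a datum list \<Rightarrow> nat \<Rightarrow> 'a cell list" where
  "left_tape pre L m = prg (rev pre) @ map Dat (rev L) @ blk m"

definition right_tape :: "'a ins list \<Rightarrow> 'a datum list \<Rightarrow> nat \<Rightarrow> 'a cell list" where
  "right_tape suf R n = prg suf @ map Dat R @ blk n"

definition running :: "'a state \<Rightarrow> 'a ins list \<Rightarrow> 'a ins list \<Rightarrow> 'a datum list \<Rightarrow> 'a datum list \<Rightarrow> 'a conf set" where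
  "running s P suf L R = {(s, left_tape pre L m, right_tape suf R n) | pre m n. P = pre @ suf}"

text \<open>The head is just left of the marked instruction \<open>i\<close>; the next label will be
  searched in \<open>suf\<close>, behind the mark.\<close>

definition popping :: "'a ins list \<Rightarrow> 'a ins list \<Rightarrow> 'a datum list \<Rightarrow> 'a datum list \<Rightarrow> 'a conf set" where
  "popping P suf L R =
    {lft Pop (left_tape pre L m) (Ins True i # right_tape suf R n) | pre i m n. P = pre @ i # suf}"

definition leads :: "'a conf set \<Rightarrow> 'a conf set \<Rightarrow> bool"  (infix "\<leadsto>" 50) where
  "C \<leadsto> D \<longleftrightarrow> (\<forall>c\<in>C. \<exists>d\<in>D. reach c d)"

lemma leads_refl [simp]: "C \<leadsto> C"
  unfolding leads_def using reach_refl by blast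

lemma leads_trans [trans]: "C \<leadsto> D \<Longrightarrow> D \<leadsto> E \<Longrightarrow> C \<leadsto> E"
  unfolding leads_def using reach_trans by meson

lemma runningI: "P = pre @ suf \<Longrightarrow> (s, left_tape pre L m, right_tape suf R n) \<in> running s P suf L R"
  unfolding running_def by blast

lemma poppingI:
  "P = pre @ i # suf \<Longrightarrow>
    lft Pop (left_tape pre L m) (Ins True i # right_tape suf R n) \<in> popping P suf L R"
  unfolding popping_def by blast

lemma right_tape_Cons [simp]: "right_tape (i # suf) R n = Ins False i # right_tape suf R n"
  by (simp add: right_tape_def)

lemma left_tape_snoc [simp]: "left_tape (pre @ [i]) L m = Ins False i # left_tape pre L m"
  by (simp add: left_tape_def)

section \<open>Effect of the single instructions\<close>

lemma run_Nop: "running Ex P (Nop # suf) L R \<leadsto> running Ex P suf L R"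
proof -
  have "reach (Ex, left_tape pre L m, right_tape (Nop # suf) R n)
      (Ex, left_tape (pre @ [Nop]) L m, right_tape suf R n)" for pre m n
    using reach_right[of Ex "right_tape (Nop # suf) R n"] by simp
  then show ?thesis unfolding leads_def running_def by fastforce
qed

text \<open>Common to \<open>PushLeft\<close>, \<open>MoveEnd\<close> and
  \<open>MoveStrokes\<close>. The truncated \<open>m - 1\<close> covers both an explicit blank that
  is used up and a cell beyond the list.\<close>

lemma push_left:
  "reach (lft (PushL d) (left_tape pre L m) (Ins True i # rs))
     (BackR, left_tape pre (d # L) (m - 1), Ins True i # rs)"
proof -
  let ?w = "prg (rev pre) @ map Dat (rev L)"
  have "reach (lft (PushL d) (?w @ blk m) (Ins True i # rs))
      (lft (PushL d) (blk m) (rev ?w @ Ins True i # rs))"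
    by (rule scan_left) auto
  also have "\<dots> = (PushL d, blk (m - 1), Blk # rev ?w @ Ins True i # rs)"
    by (simp add: lft_def)
  also have "reach \<dots> (BackR, Dat d # blk (m - 1), rev ?w @ Ins True i # rs)"
    using reach_right[of "PushL d" "Blk # rev ?w @ Ins True i # rs"] by simp
  also have "reach \<dots> (BackR, rev (rev ?w) @ Dat d # blk (m - 1), Ins True i # rs)"
    by (rule scan_right) auto
  finally show ?thesis by (simp add: left_tape_def)
qed

lemma run_PushLeft: "running Ex P (PushLeft d # suf) L R \<leadsto> running Ex P suf (d # L) R"
  unfolding leads_def
proof
  fix c assume "c \<in> running Ex P (PushLeft d # suf) L R"
  then obtain pre m n where P: "P = pre @ PushLeft d # suf"
    and c: "c = (Ex, left_tape pre L m, right_tape (PushLeft d # suf) R n)"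
    unfolding running_def by blast
  have "reach c (lft (PushL d) (left_tape pre L m) (Ins True (PushLeft d) # right_tape suf R n))"
    unfolding c using reach_left[of Ex "right_tape (PushLeft d # suf) R n"] by simp
  also note push_left
  also have "reach (BackR, left_tape pre (d # L) (m - 1), Ins True (PushLeft d) # right_tape suf R n)
      (Ex, left_tape (pre @ [PushLeft d]) (d # L) (m - 1), right_tape suf R n)"
    using reach_right[of BackR "Ins True (PushLeft d) # right_tape suf R n"] by simp
  finally show "\<exists>c'\<in>running Ex P suf (d # L) R. reach c c'"
    using P by (intro bexI[OF _ runningI]) auto
qed

lemma run_PushRight: "running Ex P (PushRight d # suf) L R \<leadsto> running Ex P suf L (R @ [d])"
  unfolding leads_def
proof
  fix c assume "c \<in> running Ex P (PushRight d # suf) L R"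
  then obtain pre m n where P: "P = pre @ PushRight d # suf"
    and c: "c = (Ex, left_tape pre L m, right_tape (PushRight d # suf) R n)"
    unfolding running_def by blast
  let ?w = "prg suf @ map Dat R" and ?ls = "Ins True (PushRight d) # left_tape pre L m"
  have "reach c (PushR d, ?ls, ?w @ blk n)"
    unfolding c using reach_right[of Ex "right_tape (PushRight d # suf) R n"] by (simp add: right_tape_def)
  also have "reach \<dots> (PushR d, rev ?w @ ?ls, blk n)"
    by (rule scan_right) auto
  also have "reach \<dots> (lft BackL (rev ?w @ ?ls) (Dat d # blk (n - 1)))"
    using reach_left[of "PushR d" "blk n"] by simp
  also have "reach \<dots> (lft BackL ?ls (rev (rev ?w) @ Dat d # blk (n - 1)))"
    by (rule scan_left) auto
  also have "\<dots> = (BackL, left_tape pre L m, Ins True (PushRight d) # right_tape suf (R @ [d]) (n - 1))"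
    by (simp add: lft_def right_tape_def)
  also have "reach \<dots> (Ex, left_tape (pre @ [PushRight d]) L m, right_tape suf (R @ [d]) (n - 1))"
    using reach_right[of BackL "Ins True (PushRight d) # right_tape suf (R @ [d]) (n - 1)"] by simp
  finally show "\<exists>c'\<in>running Ex P suf L (R @ [d]). reach c c'"
    using P by (intro bexI[OF _ runningI]) auto
qed

text \<open>\<open>AtEnd\<close> finds an instruction instead of a datum: the right stack is empty,
  the cell of \<open>T\<close> to be fetched is blank, and its code is
  \<open>End None\<close>.\<close>

lemma run_MoveEnd_Nil: "suf \<noteq> [] \<Longrightarrow> running Ex P (MoveEnd # suf) L [] \<leadsto> running Ex P suf (End None # L) []"
  unfolding leads_def
proof
  assume "suf \<noteq> []"
  then obtain suf' i where suf: "suf = suf' @ [i]" by (metis rev_exhaust)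
  fix c assume "c \<in> running Ex P (MoveEnd # suf) L []"
  then obtain pre m n where P: "P = pre @ MoveEnd # suf"
    and c: "c = (Ex, left_tape pre L m, right_tape (MoveEnd # suf) [] n)"
    unfolding running_def by blast
  let ?ls = "Ins True MoveEnd # left_tape pre L m"
  have "reach c (GoEnd, ?ls, prg suf @ blk n)"
    unfolding c using reach_right[of Ex "right_tape (MoveEnd # suf) [] n"] by (simp add: right_tape_def)
  also have "reach \<dots> (GoEnd, rev (prg suf) @ ?ls, blk n)"
    by (rule scan_right) auto
  also have "reach \<dots> (lft AtEnd (rev (prg suf) @ ?ls) (Blk # blk (n - 1)))"
    using reach_left[of GoEnd "blk n"] by simp
  also have "\<dots> = (AtEnd, rev (prg suf') @ ?ls, Ins False i # blk (Suc (n - 1)))"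
    by (simp add: suf lft_def)
  also have "reach \<dots> (lft (PushL (End None)) (rev (prg suf') @ ?ls) (Ins False i # blk (Suc (n - 1))))"
    using reach_left[of AtEnd "Ins False i # blk (Suc (n - 1))"] by simp
  also have "reach \<dots> (lft (PushL (End None)) ?ls (rev (rev (prg suf')) @ Ins False i # blk (Suc (n - 1))))"
    by (rule scan_left) auto
  also have "\<dots> = (PushL (End None), left_tape pre L m, Ins True MoveEnd # right_tape suf [] (Suc (n - 1)))"
    by (simp add: lft_def right_tape_def suf)
  also have "reach \<dots> (lft (PushL (End None)) (left_tape pre L m) (Ins True MoveEnd # right_tape suf [] (Suc (n - 1))))"
    using reach_left[of "PushL (End None)" "Ins True MoveEnd # right_tape suf [] (Suc (n - 1))"] by simp
  also note push_left
  also have "reach (BackR, left_tape pre (End None # L) (m - 1), Ins True MoveEnd # right_tape suf [] (Suc (n - 1)))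
      (Ex, left_tape (pre @ [MoveEnd]) (End None # L) (m - 1), right_tape suf [] (Suc (n - 1)))"
    using reach_right[of BackR "Ins True MoveEnd # right_tape suf [] (Suc (n - 1))"] by simp
  finally show "\<exists>c'\<in>running Ex P suf (End None # L) []. reach c c'"
    using P by (intro bexI[OF _ runningI]) auto
qed

lemma transfer:
  assumes "\<And>c. c \<noteq> Blk \<Longrightarrow> \<delta> g c = Some (g, c, MoveR)" "\<delta> g Blk = Some (g', Blk, MoveL)"
    "\<delta> g' (Dat d) = Some (PushL d, Blk, MoveL)" "\<delta> Ex (Ins False i) = Some (g, Ins True i, MoveR)"
  shows "\<exists>n'. reach (Ex, left_tape pre L m, right_tape (i # suf) (R @ [d]) n)
      (BackR, left_tape pre (d # L) (m - 1), Ins True i # right_tape suf R n')"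
proof
  \<comment> \<open>One blank of \<open>?rs\<close> replaces the datum taken off, another is the
    cell in which \<open>g\<close> turned around.\<close>
  let ?ls = "Ins True i # left_tape pre L m" and ?w = "prg suf @ map Dat R"
    and ?rs = "blk (Suc (Suc (n - 1)))"
  have "reach (Ex, left_tape pre L m, right_tape (i # suf) (R @ [d]) n) (g, ?ls, (?w @ [Dat d]) @ blk n)"
    using reach_right[of Ex "right_tape (i # suf) (R @ [d]) n"] assms(4) by (simp add: right_tape_def)
  also have "reach \<dots> (g, rev (?w @ [Dat d]) @ ?ls, blk n)"
    by (rule scan_right) (auto simp: assms(1))
  also have "reach \<dots> (lft g' (rev (?w @ [Dat d]) @ ?ls) (Blk # blk (n - 1)))"
    using reach_left[of g "blk n"] assms(2) by simp
  also have "\<dots> = (g', rev ?w @ ?ls, Dat d # Blk # blk (n - 1))"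
    by (simp add: lft_def)
  also have "reach \<dots> (lft (PushL d) (rev ?w @ ?ls) ?rs)"
    using reach_left[of g' "Dat d # Blk # blk (n - 1)"] assms(3) by simp
  also have "reach \<dots> (lft (PushL d) ?ls (rev (rev ?w) @ ?rs))"
    by (rule scan_left) auto
  also have "\<dots> = (PushL d, left_tape pre L m, Ins True i # right_tape suf R (Suc (Suc (n - 1))))"
    by (simp add: lft_def right_tape_def)
  also have "reach \<dots> (lft (PushL d) (left_tape pre L m) (Ins True i # right_tape suf R (Suc (Suc (n - 1)))))"
    using reach_left[of "PushL d" "Ins True i # right_tape suf R (Suc (Suc (n - 1)))"] by simp
  also note push_left
  finally show "reach (Ex, left_tape pre L m, right_tape (i # suf) (R @ [d]) n)
      (BackR, left_tape pre (d # L) (m - 1), Ins True i # right_tape suf R (Suc (Suc (n - 1))))" .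
qed

lemma run_MoveEnd_snoc: "running Ex P (MoveEnd # suf) L (R @ [d]) \<leadsto> running Ex P suf (d # L) R"
  unfolding leads_def
proof
  fix c assume "c \<in> running Ex P (MoveEnd # suf) L (R @ [d])"
  then obtain pre m n where P: "P = pre @ MoveEnd # suf"
    and c: "c = (Ex, left_tape pre L m, right_tape (MoveEnd # suf) (R @ [d]) n)"
    unfolding running_def by blast
  have "\<exists>n'. reach c (BackR, left_tape pre (d # L) (m - 1), Ins True MoveEnd # right_tape suf R n')"
    unfolding c by (rule transfer[of GoEnd AtEnd]) auto
  then obtain n' where "reach c (BackR, left_tape pre (d # L) (m - 1), Ins True MoveEnd # right_tape suf R n')" by blast
  also have "reach \<dots> (Ex, left_tape (pre @ [MoveEnd]) (d # L) (m - 1), right_tape suf R n')"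
    using reach_right[of BackR "Ins True MoveEnd # right_tape suf R n'"] by simp
  finally show "\<exists>c'\<in>running Ex P suf (d # L) R. reach c c'"
    using P by (intro bexI[OF _ runningI]) auto
qed

text \<open>\<open>BackR\<close> stays on \<open>MoveStrokes\<close>, so the instruction is a loop
  that repeats itself while strokes are on top.\<close>

lemma run_MoveStrokes_Stroke: "running Ex P (MoveStrokes # suf) L (R @ [Stroke]) \<leadsto> running Ex P (MoveStrokes # suf) (Stroke # L) R"
  unfolding leads_def
proof
  fix c assume "c \<in> running Ex P (MoveStrokes # suf) L (R @ [Stroke])"
  then obtain pre m n where P: "P = pre @ MoveStrokes # suf"
    and c: "c = (Ex, left_tape pre L m, right_tape (MoveStrokes # suf) (R @ [Stroke]) n)"
    unfolding running_def by blast
  have "\<exists>n'. reach c (BackR, left_tape pre (Stroke # L) (m - 1), Ins True MoveStrokes # right_tape suf R n')"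
    unfolding c by (rule transfer[of GoStrokes AtStrokes]) auto
  then obtain n' where "reach c (BackR, left_tape pre (Stroke # L) (m - 1), Ins True MoveStrokes # right_tape suf R n')" by blast
  also have "reach \<dots> (Ex, left_tape pre (Stroke # L) (m - 1), right_tape (MoveStrokes # suf) R n')"
    using reach_stay[of BackR "Ins True MoveStrokes # right_tape suf R n'"] by simp
  finally show "\<exists>c'\<in>running Ex P (MoveStrokes # suf) (Stroke # L) R. reach c c'"
    using P by (intro bexI[OF _ runningI]) auto
qed

lemma run_MoveStrokes_skip:
  assumes "suf \<noteq> []" "R = [] \<or> last R \<noteq> Stroke"
  shows "running Ex P (MoveStrokes # suf) L R \<leadsto> running Ex P suf L R"
  unfolding leads_def
proof
  have "prg suf @ map Dat R \<noteq> []" using assms(1) by simp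
  \<comment> \<open>\<open>d\<close> is the cell tested by \<open>AtStrokes\<close>: the top of the
    right stack or, if that is empty, the last cell of the program.\<close>
  then obtain w d where w: "prg suf @ map Dat R = w @ [d]" by (metis rev_exhaust)
  have d: "d \<noteq> Dat Stroke"
  proof (cases "R = []")
    case True
    then show ?thesis using w assms(1) by (metis Cons_eq_map_conv append_self_conv cell.distinct(5) last_map last_snoc map_is_Nil_conv)
  next
    case False
    then have "d = Dat (last R)" using w by (metis last_appendR last_map last_snoc map_is_Nil_conv)
    then show ?thesis using assms(2) False by simp
  qed
  have wd: "set (w @ [d]) \<subseteq> range (Ins False) \<union> range Dat"
    unfolding w[symmetric] by auto
  then have no_mark: "c \<in> set (w @ [d]) \<Longrightarrow> c \<noteq> Blk \<and> (\<forall>i. c \<noteq> Ins True i)" for c by auto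
  have goes_back: "c \<in> set (w @ [d]) \<Longrightarrow> \<delta> BackL c = Some (BackL, c, MoveL)" for c
    using wd by auto
  fix c assume "c \<in> running Ex P (MoveStrokes # suf) L R"
  then obtain pre m n where P: "P = pre @ MoveStrokes # suf"
    and c: "c = (Ex, left_tape pre L m, right_tape (MoveStrokes # suf) R n)"
    unfolding running_def by blast
  let ?ls = "Ins True MoveStrokes # left_tape pre L m" and ?rs = "blk (Suc (n - 1))"
  have rt: "right_tape suf R k = w @ d # blk k" for k
    using w by (simp add: right_tape_def flip: append_assoc)
  have "reach c (GoStrokes, ?ls, (w @ [d]) @ blk n)"
    unfolding c using reach_right[of Ex "right_tape (MoveStrokes # suf) R n"] by (simp add: rt)
  also have "reach \<dots> (GoStrokes, rev (w @ [d]) @ ?ls, blk n)"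
    by (rule scan_right) (use no_mark in auto)
  also have "reach \<dots> (lft AtStrokes (rev (w @ [d]) @ ?ls) ?rs)"
    using reach_left[of GoStrokes "blk n"] by simp
  also have "\<dots> = (AtStrokes, rev w @ ?ls, d # ?rs)"
    by (simp add: lft_def)
  also have "reach \<dots> (BackL, rev w @ ?ls, d # ?rs)"
    using reach_stay[of AtStrokes "d # ?rs"] d by simp
  also have "reach \<dots> (lft BackL (rev w @ ?ls) (d # ?rs))"
    using reach_left[of BackL "d # ?rs"] goes_back by simp
  also have "reach \<dots> (lft BackL ?ls (rev (rev w) @ d # ?rs))"
    by (rule scan_left) (use goes_back in auto)
  also have "\<dots> = (BackL, left_tape pre L m, Ins True MoveStrokes # right_tape suf R (Suc (n - 1)))"
    by (simp add: lft_def rt)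
  also have "reach \<dots> (Ex, left_tape (pre @ [MoveStrokes]) L m, right_tape suf R (Suc (n - 1)))"
    using reach_right[of BackL "Ins True MoveStrokes # right_tape suf R (Suc (n - 1))"] by simp
  finally show "\<exists>c'\<in>running Ex P suf L R. reach c c'"
    using P by (intro bexI[OF _ runningI]) auto
qed

text \<open>\<open>Reset\<close> runs left to an unmarked \<open>Begin\<close>; it is the right one
  because \<open>Begin\<close> occurs only at the front of \<open>P\<close>.\<close>

lemma run_Restart:
  assumes P: "P = Begin # P1" "Begin \<notin> set P1"
  shows "running Ex P (Restart # suf) L R \<leadsto> popping P P1 L R"
  unfolding leads_def
proof
  fix c assume "c \<in> running Ex P (Restart # suf) L R"
  then obtain pre m n where pre: "P = pre @ Restart # suf"
    and c: "c = (Ex, left_tape pre L m, right_tape (Restart # suf) R n)"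
    unfolding running_def by blast
  from pre P obtain pre1 where pre1: "pre = Begin # pre1" "P1 = pre1 @ Restart # suf" by (cases pre) auto
  have "reach c (lft Reset (left_tape pre L m) (right_tape (Restart # suf) R n))"
    unfolding c using reach_left[of Ex "right_tape (Restart # suf) R n"] by simp
  also have "\<dots> = lft Reset (prg (rev pre1) @ Ins False Begin # left_tape [] L m) (right_tape (Restart # suf) R n)"
    by (simp add: left_tape_def pre1)
  also have "reach \<dots> (lft Reset (Ins False Begin # left_tape [] L m) (rev (prg (rev pre1)) @ right_tape (Restart # suf) R n))"
    by (rule scan_left) (use P pre1 in auto)
  also have "\<dots> = (Reset, left_tape [] L m, Ins False Begin # right_tape P1 R n)"
    by (simp add: lft_def right_tape_def pre1 rev_map)
  also have "reach \<dots> (lft Pop (left_tape [] L m) (Ins True Begin # right_tape P1 R n))"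
    using reach_left[of Reset "Ins False Begin # right_tape P1 R n"] by simp
  finally show "\<exists>c'\<in>popping P P1 L R. reach c c'"
    using P by (intro bexI[OF _ poppingI]) auto
qed

section \<open>Popping, search for labels, stopping\<close>

lemma pop_left:
  "reach (lft Pop (left_tape pre L m) rs)
     (AtPop, Blk # blk (m - 1), map Dat L @ prg pre @ rs)"
proof -
  let ?w = "prg (rev pre) @ map Dat (rev L)"
  have "reach (lft Pop (?w @ blk m) rs) (lft Pop (blk m) (rev ?w @ rs))"
    by (rule scan_left) auto
  also have "\<dots> = (Pop, blk (m - 1), Blk # rev ?w @ rs)"
    by (simp add: lft_def)
  also have "reach \<dots> (AtPop, Blk # blk (m - 1), rev ?w @ rs)"
    using reach_right[of Pop "Blk # rev ?w @ rs"] by simp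
  finally show ?thesis by (simp add: left_tape_def rev_map)
qed

text \<open>\<open>Ret\<close> stops at the mark, so the search starts behind it. Successive strokes
  therefore lead further and further to the right.\<close>

lemma pop_Cons: "popping P suf (d # L) R \<leadsto> running (Find d) P suf L R"
  unfolding leads_def
proof
  fix c assume "c \<in> popping P suf (d # L) R"
  then obtain pre i m n where P: "P = pre @ i # suf"
    and c: "c = lft Pop (left_tape pre (d # L) m) (Ins True i # right_tape suf R n)"
    unfolding popping_def by blast
  let ?rs = "Ins True i # right_tape suf R n" and ?ls = "blk (Suc (Suc (m - 1)))"
  have "reach c (AtPop, Blk # blk (m - 1), Dat d # map Dat L @ prg pre @ ?rs)"
    unfolding c using pop_left[of pre "d # L" m ?rs] by simp
  also have "reach \<dots> (Ret d, ?ls, (map Dat L @ prg pre) @ ?rs)"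
    using reach_right[of AtPop "Dat d # map Dat L @ prg pre @ ?rs"] by simp
  also have "reach \<dots> (Ret d, rev (map Dat L @ prg pre) @ ?ls, ?rs)"
    by (rule scan_right) auto
  also have "\<dots> = (Ret d, left_tape pre L (Suc (Suc (m - 1))), ?rs)"
    by (simp add: left_tape_def rev_map)
  also have "reach \<dots> (Find d, left_tape (pre @ [i]) L (Suc (Suc (m - 1))), right_tape suf R n)"
    using reach_right[of "Ret d" ?rs] by simp
  finally show "\<exists>c'\<in>running (Find d) P suf L R. reach c c'"
    using P by (intro bexI[OF _ runningI]) auto
qed

text \<open>An empty left stack means that only blanks of \<open>T\<close> are left there, and
  \<open>End None\<close> is the code of a blank.\<close>

lemma pop_Nil: "popping P suf [] R \<leadsto> running (Find (End None)) P suf [] R"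
  unfolding leads_def
proof
  fix c assume "c \<in> popping P suf [] R"
  then obtain pre i m n where P: "P = pre @ i # suf"
    and c: "c = lft Pop (left_tape pre [] m) (Ins True i # right_tape suf R n)"
    unfolding popping_def by blast
  let ?rs = "Ins True i # right_tape suf R n" and ?ls = "blk (Suc (m - 1))"
  \<comment> \<open>\<open>AtPop\<close> recognizes the empty stack by an instruction cell: the
    first of \<open>pre\<close>, or the marked one if \<open>pre\<close> is empty.\<close>
  obtain b j rs where rs: "prg pre @ ?rs = Ins b j # rs" by (cases pre) auto
  have "reach c (AtPop, ?ls, prg pre @ ?rs)"
    unfolding c using pop_left[of pre "[]" m ?rs] by simp
  also have "reach \<dots> (Ret (End None), ?ls, prg pre @ ?rs)"
    unfolding rs using reach_stay[of AtPop "Ins b j # rs"] by simp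
  also have "reach \<dots> (Ret (End None), rev (prg pre) @ ?ls, ?rs)"
    by (rule scan_right) auto
  also have "\<dots> = (Ret (End None), left_tape pre [] (Suc (m - 1)), ?rs)"
    by (simp add: left_tape_def rev_map)
  also have "reach \<dots> (Find (End None), left_tape (pre @ [i]) [] (Suc (m - 1)), right_tape suf R n)"
    using reach_right[of "Ret (End None)" ?rs] by simp
  finally show "\<exists>c'\<in>running (Find (End None)) P suf [] R. reach c c'"
    using P by (intro bexI[OF _ runningI]) auto
qed

lemma find_skip:
  assumes "Label d \<notin> set w"
  shows "running (Find d) P (w @ suf) L R \<leadsto> running (Find d) P suf L R"
  unfolding leads_def
proof
  fix c assume "c \<in> running (Find d) P (w @ suf) L R"
  then obtain pre m n where P: "P = pre @ w @ suf"
    and c: "c = (Find d, left_tape pre L m, right_tape (w @ suf) R n)"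
    unfolding running_def by blast
  have "reach (Find d, left_tape pre L m, prg w @ right_tape suf R n)
      (Find d, rev (prg w) @ left_tape pre L m, right_tape suf R n)"
    by (rule scan_right) (use assms in auto)
  then have "reach c (Find d, left_tape (pre @ w) L m, right_tape suf R n)"
    by (simp add: c left_tape_def right_tape_def rev_map)
  then show "\<exists>c'\<in>running (Find d) P suf L R. reach c c'"
    using P by (intro bexI[OF _ runningI]) auto
qed

lemma find_Stroke: "running (Find Stroke) P (Label Stroke # suf) L R \<leadsto> popping P suf L R"
proof -
  have "reach (Find Stroke, left_tape pre L m, right_tape (Label Stroke # suf) R n)
      (lft Pop (left_tape pre L m) (Ins True (Label Stroke) # right_tape suf R n))" for pre m n
    using reach_left[of "Find Stroke" "right_tape (Label Stroke # suf) R n"] by simp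
  then show ?thesis unfolding leads_def running_def popping_def by fastforce
qed

lemma find_End: "running (Find (End t)) P (Label (End t) # suf) L R \<leadsto> running Ex P suf L R"
proof -
  have "reach (Find (End t), left_tape pre L m, right_tape (Label (End t) # suf) R n)
      (Ex, left_tape (pre @ [Label (End t)]) L m, right_tape suf R n)" for pre m n
    using reach_right[of "Find (End t)" "right_tape (Label (End t) # suf) R n"] by simp
  then show ?thesis unfolding leads_def running_def by fastforce
qed

text \<open>The head stops at the start of the left stack, where \<open>output_word\<close> begins
  to read.\<close>

lemma run_Stop:
  "running Ex P (Stop # suf) L R \<leadsto> {(Halt, ls, map Dat L @ prg P @ rs) | ls rs. True}"
  unfolding leads_def
proof
  fix c assume "c \<in> running Ex P (Stop # suf) L R"
  then obtain pre m n where P: "P = pre @ Stop # suf"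
    and c: "c = (Ex, left_tape pre L m, right_tape (Stop # suf) R n)"
    unfolding running_def by blast
  let ?w = "prg (rev pre) @ map Dat (rev L)"
  have "reach c (lft Fin (?w @ blk m) (right_tape (Stop # suf) R n))"
    unfolding c using reach_left[of Ex "right_tape (Stop # suf) R n"] by (simp add: left_tape_def)
  also have "reach \<dots> (lft Fin (blk m) (rev ?w @ right_tape (Stop # suf) R n))"
    by (rule scan_left) auto
  also have "\<dots> = (Fin, blk (m - 1), Blk # map Dat L @ prg P @ map Dat R @ blk n)"
    by (simp add: lft_def P right_tape_def rev_map)
  also have "reach \<dots> (Halt, Blk # blk (m - 1), map Dat L @ prg P @ map Dat R @ blk n)"
    using reach_right[of Fin "Blk # map Dat L @ prg P @ map Dat R @ blk n"] by simp
  finally show "\<exists>c'\<in>{(Halt, ls, map Dat L @ prg P @ rs) | ls rs. True}. reach c c'"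
    by blast
qed


section \<open>Coding of programs and tapes\<close>

text \<open>
  On the tape, an instruction occupies as many cells as its code word in the input. The surplus
  cells are filled with \<open>Nop\<close>, so that the input can be decoded in place.
\<close>

definition pad :: "'a ins \<Rightarrow> 'a ins list" where
  "pad i = i # replicate (to_nat i) Nop"

definition padl :: "'a ins list \<Rightarrow> 'a ins list" where
  "padl is = concat (map pad is)"

lemma padl_simps [simp]:
  "padl [] = []" "padl (i # is) = i # replicate (to_nat i) Nop @ padl is"
  "padl (is @ js) = padl is @ padl js"
  by (auto simp: padl_def pad_def)

lemma set_padl: "set (padl is) \<subseteq> insert Nop (set is)"
  by (induction "is") auto

lemma run_Nops: "running Ex P (replicate k Nop @ suf) L R \<leadsto> running Ex P suf L R"
proof (induction k)
  case (Suc k)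
  then show ?case using leads_trans[OF run_Nop] by simp
qed simp

lemma run_PushLefts:
  "running Ex P (padl (map PushLeft ds) @ suf) L R \<leadsto> running Ex P suf (rev ds @ L) R"
proof (induction ds arbitrary: L)
  case (Cons d ds)
  have "running Ex P (padl (map PushLeft (d # ds)) @ suf) L R
      \<leadsto> running Ex P (replicate (to_nat (PushLeft d)) Nop @ padl (map PushLeft ds) @ suf) (d # L) R"
    using run_PushLeft by simp
  also note run_Nops
  also have "running Ex P (padl (map PushLeft ds) @ suf) (d # L) R \<leadsto> running Ex P suf (rev (d # ds) @ L) R"
    using Cons[of "d # L"] by simp
  finally show ?case .
qed simp

lemma run_PushRights:
  "running Ex P (padl (map PushRight ds) @ suf) L R \<leadsto> running Ex P suf L (R @ ds)"
proof (induction ds arbitrary: R)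
  case (Cons d ds)
  have "running Ex P (padl (map PushRight (d # ds)) @ suf) L R
      \<leadsto> running Ex P (replicate (to_nat (PushRight d)) Nop @ padl (map PushRight ds) @ suf) L (R @ [d])"
    using run_PushRight by simp
  also note run_Nops
  also have "running Ex P (padl (map PushRight ds) @ suf) L (R @ [d]) \<leadsto> running Ex P suf L (R @ d # ds)"
    using Cons[of "R @ [d]"] by simp
  finally show ?case .
qed simp

lemma run_MoveStrokes:
  assumes "suf \<noteq> []" "R = [] \<or> last R \<noteq> Stroke"
  shows "running Ex P (MoveStrokes # suf) L (R @ replicate k Stroke)
    \<leadsto> running Ex P suf (replicate k Stroke @ L) R"
proof (induction k arbitrary: L)
  case 0
  then show ?case using run_MoveStrokes_skip[OF assms] by simp
next
  case (Suc k)
  have "running Ex P (MoveStrokes # suf) L ((R @ replicate k Stroke) @ [Stroke])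
      \<leadsto> running Ex P (MoveStrokes # suf) (Stroke # L) (R @ replicate k Stroke)"
    by (rule run_MoveStrokes_Stroke)
  also note Suc[of "Stroke # L"]
  finally show ?case by (simp add: replicate_append_same replicate_app_Cons_same)
qed

section \<open>Symbols of \<open>T\<close> as data\<close>

fun strokes :: "'a symbol \<Rightarrow> nat" where
  "strokes (Aux n) = Suc n"
| "strokes _ = 0"

fun ending :: "'a symbol \<Rightarrow> 'a option" where
  "ending (Letter a) = Some a"
| "ending _ = None"

text \<open>Strokes precede the ending, so popping the left stack counts strokes before it meets the
  ending. On the right stack, whose top is at the other end, the ending comes off first; the strokes
  after it are bounded by the ending of the next symbol.\<close>

definition enc1 :: "'a symbol \<Rightarrow> 'a datum list" where
  "enc1 s = replicate (strokes s) Stroke @ [End (ending s)]"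

definition enc :: "'a symbol list \<Rightarrow> 'a datum list" where
  "enc ss = concat (map enc1 ss)"

text \<open>\<open>Aux n\<close> has \<open>n + 1\<close> strokes, hence \<open>None\<close> without
  strokes is \<open>Blank\<close>. Pairs that code no symbol get some value too, so that
  \<open>branch\<close> is total.\<close>

definition dec1 :: "nat \<Rightarrow> 'a option \<Rightarrow> 'a symbol" where
  "dec1 k t = (case t of Some a \<Rightarrow> Letter a | None \<Rightarrow> (if k = 0 then Blank else Aux (k - 1)))"

lemma dec1_strokes_ending [simp]: "dec1 (strokes s) (ending s) = s"
  by (cases s) (auto simp: dec1_def)

lemma enc_simps [simp]: "enc [] = []" "enc (s # ss) = enc1 s @ enc ss" "enc (ss @ ss') = enc ss @ enc ss'"
  by (auto simp: enc_def)

lemma last_enc: "enc ss = [] \<or> last (enc ss) \<noteq> Stroke"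
  by (induction ss rule: rev_induct) (auto simp: enc1_def)

lemma enc_Letters: "enc (map Letter p) = map (End \<circ> Some) p"
  by (induction p) (auto simp: enc1_def)

text \<open>The code of a nonletter starts with a stroke or \<open>End None\<close>, which is no
  letter, and neither is the program cell behind the stack.\<close>

lemma takeWhile_enc:
  "takeWhile is_Letter (map cell_symbol (map Dat (enc ss) @ Ins b i # cs)) = takeWhile is_Letter ss"
proof (induction ss)
  case (Cons s ss)
  then show ?case by (cases s) (auto simp: enc1_def)
qed simp

text \<open>Fetches a whole symbol from the right stack. For an empty \<open>ls\<close> the default
  \<open>scanned [] = Blank\<close> agrees with the \<open>End None\<close> that
  \<open>MoveEnd\<close> supplies.\<close>

lemma run_MoveEnd_MoveStrokes:
  assumes "suf \<noteq> []"
  shows "running Ex P (padl [MoveEnd, MoveStrokes] @ suf) L (enc (rev ls))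
    \<leadsto> running Ex P suf (enc1 (scanned ls) @ L) (enc (rev (tl ls)))"
proof -
  let ?suf = "replicate (to_nat (MoveStrokes :: 'a ins)) Nop @ suf"
  let ?L = "End (ending (scanned ls)) # L"
  let ?R = "enc (rev (tl ls)) @ replicate (strokes (scanned ls)) Stroke"
  have "running Ex P (padl [MoveEnd, MoveStrokes] @ suf) L (enc (rev ls))
      \<leadsto> running Ex P (replicate (to_nat (MoveEnd :: 'a ins)) Nop @ MoveStrokes # ?suf) ?L ?R"
  proof (cases ls)
    case Nil
    then show ?thesis using run_MoveEnd_Nil assms by simp
  next
    case (Cons s ls')
    then show ?thesis using run_MoveEnd_snoc[of P "replicate (to_nat (MoveEnd :: 'a ins)) Nop @ MoveStrokes # ?suf" L ?R]
      by (simp add: enc1_def)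
  qed
  also note run_Nops
  also have "running Ex P (MoveStrokes # ?suf) ?L ?R
      \<leadsto> running Ex P ?suf (replicate (strokes (scanned ls)) Stroke @ ?L) (enc (rev (tl ls)))"
    by (rule run_MoveStrokes) (use assms last_enc in auto)
  also note run_Nops
  finally show ?thesis by (simp add: enc1_def)
qed

text \<open>The scanned symbol has been popped already. Moving right hands the new symbol to the
  right stack; moving left puts it on the left stack and the fetched symbol on top. Pushing onto the
  left stack reverses, hence \<open>rev\<close>.\<close>

definition write_move :: "'a symbol \<Rightarrow> move \<Rightarrow> 'a ins list" where
  "write_move x m = (case m of
      MoveL \<Rightarrow> map PushLeft (rev (enc1 x)) @ [MoveEnd, MoveStrokes]
    | Stay \<Rightarrow> map PushLeft (rev (enc1 x))
    | MoveR \<Rightarrow> map PushRight (enc1 x))"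

lemma run_write_move:
  assumes "shift m (ls, x # rs) = (ls', rs')" "suf \<noteq> []"
  shows "running Ex P (padl (write_move x m) @ suf) (enc rs) (enc (rev ls))
    \<leadsto> running Ex P suf (enc rs') (enc (rev ls'))"
proof (cases m)
  case MoveL
  have "running Ex P (padl (write_move x m) @ suf) (enc rs) (enc (rev ls))
      \<leadsto> running Ex P (padl [MoveEnd, MoveStrokes] @ suf) (enc (x # rs)) (enc (rev ls))"
    using run_PushLefts[of P "rev (enc1 x)" "padl [MoveEnd, MoveStrokes] @ suf" "enc rs"] MoveL
    by (simp add: write_move_def)
  also note run_MoveEnd_MoveStrokes[OF assms(2)]
  finally show ?thesis using assms(1) MoveL by auto
next
  case Stay
  then show ?thesis using run_PushLefts[of P "rev (enc1 x)" suf "enc rs"] assms(1)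
    by (auto simp: write_move_def)
next
  case MoveR
  then show ?thesis using run_PushRights[of P "enc1 x" suf "enc rs" "enc (rev ls)"] assms(1)
    by (auto simp: write_move_def)
qed

section \<open>The input code and its decoding in place\<close>

abbreviation lets :: "'a list \<Rightarrow> 'a cell list" where
  "lets \<equiv> map (\<lambda>a. Dat (End (Some a)))"

text \<open>Each code word starts with its only \<open>a0\<close>. Read from the right, the letters
  \<open>a1\<close> are counted up to the \<open>a0\<close>, so no separators are needed.\<close>

definition code :: "'a ins list \<Rightarrow> 'a list" where
  "code is = concat (map (\<lambda>i. a0 # replicate (to_nat i) a1) is)"

lemma code_simps [simp]: "code [] = []" "code (i # is) = a0 # replicate (to_nat i) a1 @ code is"
  "code (is @ js) = code is @ code js"
  by (auto simp: code_def)

lemma decode_count: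
  "n + k < code_bound \<Longrightarrow> reach (lft (Dec n) (lets (replicate k a1) @ ls) rs)
     (lft (Dec (n + k)) ls (prg (replicate k Nop) @ rs))"
proof (induction k arbitrary: n rs)
  case (Suc k)
  have "reach (lft (Dec n) (lets (replicate (Suc k) a1) @ ls) rs)
      (lft (Dec (Suc n)) (lets (replicate k a1) @ ls) (Ins False Nop # rs))"
    using reach_left[of "Dec n" "Dat (End (Some a1)) # rs"] Suc.prems by (simp add: lft_def)
  also have "reach \<dots> (lft (Dec (Suc n + k)) ls (prg (replicate k Nop) @ Ins False Nop # rs))"
    using Suc.IH[of "Suc n" "Ins False Nop # rs"] Suc.prems by simp
  finally show ?case by (simp add: replicate_app_Cons_same)
qed simp

lemma decode_count_ins:
  "reach (lft (Dec 0) (lets (rev (code [i])) @ ls) rs)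
     (Dec (to_nat i), ls, Dat (End (Some a0)) # prg (replicate (to_nat i) Nop) @ rs)"
  using decode_count[of 0 "to_nat i" "Dat (End (Some a0)) # ls" rs] to_nat_less_code_bound[of i]
  by (simp add: lft_def)

lemma decode_ins:
  assumes "i \<noteq> Begin"
  shows "reach (lft (Dec 0) (lets (rev (code [i])) @ ls) rs) (lft (Dec 0) ls (prg (pad i) @ rs))"
proof -
  note decode_count_ins
  also have "reach (Dec (to_nat i), ls, Dat (End (Some a0)) # prg (replicate (to_nat i) Nop) @ rs)
      (lft (Dec 0) ls (prg (pad i) @ rs))"
    using reach_left[of "Dec (to_nat i)" "Dat (End (Some a0)) # prg (replicate (to_nat i) Nop) @ rs"]
      to_nat_less_code_bound[of i] distinct_letters assms
    by (simp add: pad_def leD not_le)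
  finally show ?thesis .
qed

lemma decode_list:
  "Begin \<notin> set is \<Longrightarrow>
    reach (lft (Dec 0) (lets (rev (code is)) @ ls) rs) (lft (Dec 0) ls (prg (padl is) @ rs))"
proof (induction "is" arbitrary: rs rule: rev_induct)
  case (snoc i "is")
  have "reach (lft (Dec 0) (lets (rev (code (is @ [i]))) @ ls) rs)
      (lft (Dec 0) (lets (rev (code is)) @ ls) (prg (pad i) @ rs))"
    using decode_ins[of i "lets (rev (code is)) @ ls" rs] snoc.prems by auto
  also have "reach \<dots> (lft (Dec 0) ls (prg (padl is) @ prg (pad i) @ rs))"
    using snoc by simp
  finally show ?case by (simp add: pad_def)
qed simp

text \<open>\<open>p\<close> may be any word: its letters are never decoded, since
  \<open>Begin\<close> sends the machine to \<open>Pop\<close>. The final \<open>Blk\<close> is the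
  cell in which \<open>Init\<close> turned.\<close>

lemma decode_program:
  assumes "Begin \<notin> set is"
  shows "reach (Init, [], lets (p @ code (Begin # is)))
    (lft Pop (lets (rev p)) (Ins True Begin # prg (tl (padl (Begin # is))) @ [Blk]))"
proof -
  let ?n = "to_nat (Begin :: 'a ins)"
  have "reach (Init, [], lets (p @ code (Begin # is)) @ [])
      (Init, rev (lets (p @ code (Begin # is))) @ [], [])"
    by (rule scan_right) auto
  also have "reach \<dots> (lft (Dec 0) (rev (lets (p @ code (Begin # is)))) [Blk])"
    using reach_left[of Init "[]"] by simp
  also have "\<dots> = lft (Dec 0) (lets (rev (code is)) @ lets (rev (code [Begin])) @ lets (rev p)) [Blk]"
    by (simp add: rev_map)
  also note decode_list[OF assms]
  also note decode_count_ins
  also have "reach (Dec ?n, lets (rev p), Dat (End (Some a0)) # prg (replicate ?n Nop) @ prg (padl is) @ [Blk])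
      (lft Pop (lets (rev p)) (Ins True Begin # prg (replicate ?n Nop) @ prg (padl is) @ [Blk]))"
    using reach_left[of "Dec ?n" "Dat (End (Some a0)) # prg (replicate ?n Nop) @ prg (padl is) @ [Blk]"]
      to_nat_less_code_bound[of Begin] distinct_letters by (simp add: leD not_le)
  finally show ?thesis by simp
qed

section \<open>From reachability to results\<close>

lemma while_option_halted:
  "(step M ^^ k) c = d \<Longrightarrow> halted M d \<Longrightarrow> while_option (\<lambda>c. \<not> halted M c) (step M) c = Some d"
proof (induction k arbitrary: c)
  case 0
  then show ?case by (subst while_option_unfold) simp
next
  case (Suc k)
  show ?case
  proof (cases "halted M c")
    case True
    then have "step M c = c" by (cases c) auto
    then have "(step M ^^ n) c = c" for n by (induction n) auto
    then have "c = d" using Suc.prems by metis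
    then show ?thesis using Suc.prems by (subst while_option_unfold) simp
  next
    case False
    then show ?thesis using Suc.IH[of "step M c"] Suc.prems
      by (subst while_option_unfold) (simp add: funpow_swap1)
  qed
qed

text \<open>Since \<open>step\<close> fixes halted configurations, the number of steps behind
  \<open>reach\<close> may exceed the halting time.\<close>

lemma reach_halted:
  "reach c d \<Longrightarrow> halted universal (conc d) \<Longrightarrow>
    while_option (\<lambda>c. \<not> halted universal c) (step universal) (conc c) = Some (conc d)"
  unfolding reach_def using while_option_halted by blast

end

section \<open>Simulation\<close>

text \<open>Strict bounds for the states entered and the strokes written by \<open>T\<close>; being
  positive, they also cover the initial state and the input symbols, which have no strokes.\<close>

locale compilation = two_letters a0 a1 for a0 a1 :: "'a::finite" +
  fixes T :: "'a tm" and S Q :: nat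
  assumes bounds: "fmlookup T (q, s) = Some (q', x, m) \<Longrightarrow> q' < Q \<and> strokes x < S"
    and pos: "0 < S" "0 < Q"
begin

section \<open>The compiled program\<close>

definition action :: "nat \<Rightarrow> 'a symbol \<Rightarrow> 'a ins list" where
  "action q s = (case fmlookup T (q, s) of
      None \<Rightarrow> [PushLeft (End (ending s)), Stop]
    | Some (q', x, m) \<Rightarrow> write_move x m @ map PushLeft (replicate (q' * S) Stroke) @ [Restart])"

definition endings :: "'a option list" where
  "endings = (SOME ts. set ts = UNIV)"

lemma set_endings [simp]: "set endings = UNIV"
  unfolding endings_def by (rule someI_ex) (simp add: finite_list)

text \<open>Segment \<open>q * S + k\<close> handles the symbols with \<open>k\<close> strokes in state \<open>q\<close>.\<close>

definition branch :: "nat \<Rightarrow> 'a option \<Rightarrow> 'a ins list" where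
  "branch j t = Label (End t) # action (j div S) (dec1 (j mod S) t)"

definition entry :: "nat \<Rightarrow> 'a ins list" where
  "entry j = concat (map (branch j) endings)"

definition segments :: "nat \<Rightarrow> 'a ins list" where
  "segments j = concat (map (\<lambda>j. entry j @ [Label Stroke]) [j..<Q * S])"

definition program :: "'a ins list" where
  "program = Begin # segments 0"

lemma segments_unfold: "j < Q * S \<Longrightarrow> segments j = entry j @ Label Stroke # segments (Suc j)"
  by (simp add: segments_def upt_conv_Cons)

text \<open>Hence neither a search for a label nor \<open>Reset\<close> can stop inside an
  action.\<close>

lemma action_no_labels: "i \<in> set (action q s) \<Longrightarrow> i \<noteq> Begin \<and> i \<noteq> Label d"
proof -
  have "i \<in> set (write_move x m) \<Longrightarrow> i \<noteq> Begin \<and> i \<noteq> Label d" for x m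
    by (cases m) (auto simp: write_move_def)
  then show "i \<in> set (action q s) \<Longrightarrow> i \<noteq> Begin \<and> i \<noteq> Label d"
    by (auto simp: action_def split: option.splits)
qed

lemma Begin_notin_segments: "Begin \<notin> set (segments j)"
  unfolding segments_def entry_def branch_def by (auto dest: action_no_labels)

lemma Stroke_notin_entry: "Label Stroke \<notin> set (entry j)"
  unfolding entry_def branch_def by (auto dest: action_no_labels)

abbreviation Pr :: "'a ins list" where "Pr \<equiv> padl program"

lemma find_ending:
  "\<exists>suf'. running (Find (End t)) Pr (padl (entry j) @ suf) L R
    \<leadsto> running Ex Pr (padl (action (j div S) (dec1 (j mod S) t)) @ suf') L R"
proof -
  have "t \<in> set endings" by simp
  then obtain us vs where ts: "endings = us @ t # vs" "t \<notin> set us"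
    by (metis split_list_first)
  let ?a = "action (j div S) (dec1 (j mod S) t)"
  let ?w = "padl (concat (map (branch j) us))" and ?v = "padl (concat (map (branch j) vs)) @ suf"
  let ?n = "to_nat (Label (End t))"
  have "Label (End t) \<notin> set ?w"
    using set_padl[of "concat (map (branch j) us)"] ts(2)
    by (auto simp: branch_def dest: action_no_labels)
  then have "running (Find (End t)) Pr (padl (entry j) @ suf) L R
      \<leadsto> running (Find (End t)) Pr (Label (End t) # replicate ?n Nop @ padl ?a @ ?v) L R"
    using find_skip[of "End t" ?w Pr "Label (End t) # replicate ?n Nop @ padl ?a @ ?v" L R]
    by (simp add: entry_def ts(1) branch_def)
  also note find_End
  also note run_Nops
  finally show ?thesis by blast
qed

text \<open>Each stroke leads to the end of the current segment, so \<open>k\<close> strokes pass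
  \<open>k\<close> segments. The \<open>Nop\<close>s in front are the padding of the marked
  instruction, \<open>Begin\<close> or a stroke label.\<close>

lemma pop_strokes:
  "j + k < Q * S \<Longrightarrow> \<exists>r'. popping Pr (replicate r Nop @ padl (segments j)) (replicate k Stroke @ L) R
    \<leadsto> popping Pr (replicate r' Nop @ padl (segments (j + k))) L R"
proof (induction k arbitrary: j r)
  case 0
  show ?case by (intro exI[of _ r]) simp
next
  case (Suc k)
  let ?r = "to_nat (Label Stroke :: 'a ins)" and ?w = "replicate r Nop @ padl (entry j)"
  let ?suf = "replicate ?r Nop @ padl (segments (Suc j))" and ?L = "replicate k Stroke @ L"
  have "popping Pr (replicate r Nop @ padl (segments j)) (replicate (Suc k) Stroke @ L) R
      \<leadsto> running (Find Stroke) Pr (?w @ Label Stroke # ?suf) ?L R"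
    using pop_Cons Suc.prems by (simp add: segments_unfold)
  also have "\<dots> \<leadsto> running (Find Stroke) Pr (Label Stroke # ?suf) ?L R"
    by (rule find_skip) (use Stroke_notin_entry set_padl[of "entry j"] in auto)
  also note find_Stroke
  finally have *: "popping Pr (replicate r Nop @ padl (segments j)) (replicate (Suc k) Stroke @ L) R
      \<leadsto> popping Pr ?suf ?L R" .
  obtain r' where "popping Pr ?suf ?L R \<leadsto> popping Pr (replicate r' Nop @ padl (segments (j + Suc k))) L R"
    using Suc.IH[of "Suc j" ?r] Suc.prems by auto
  with * show ?case by (intro exI) (rule leads_trans)
qed

section \<open>The simulation invariant\<close>

fun rep :: "'a config \<Rightarrow> 'a conf set" where
  "rep (q, ls, rs) = popping Pr (tl Pr) (replicate (q * S) Stroke @ enc rs) (enc (rev ls))"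

text \<open>Keeps the segment number, \<open>q * S\<close> plus the strokes of the scanned symbol,
  below the number \<open>Q * S\<close> of segments.\<close>

fun valid :: "'a config \<Rightarrow> bool" where
  "valid (q, ls, rs) \<longleftrightarrow> q < Q \<and> (\<forall>s \<in> set ls \<union> set rs. strokes s < S)"

lemma dispatch:
  assumes "valid (q, ls, rs)"
  shows "\<exists>suf. rep (q, ls, rs)
    \<leadsto> running Ex Pr (padl (action q (scanned rs)) @ suf) (enc (tl rs)) (enc (rev ls))"
proof -
  let ?k = "strokes (scanned rs)" and ?t = "ending (scanned rs)" and ?R = "enc (rev ls)"
  \<comment> \<open>For \<open>rs = []\<close> nothing lies below the strokes;
    \<open>pop_Nil\<close> then supplies the same ending \<open>None\<close>, that of
    \<open>Blank\<close>.\<close>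
  define L where "L = (if rs = [] then [] else End ?t # enc (tl rs))"
  have k: "?k < S" using assms pos by (cases rs) auto
  have "Suc q * S \<le> Q * S" using assms by (intro mult_le_mono1) simp
  then have j: "q * S + ?k < Q * S" using k by simp
  have "rep (q, ls, rs) = popping Pr (replicate (to_nat (Begin :: 'a ins)) Nop @ padl (segments 0))
      (replicate (q * S + ?k) Stroke @ L) ?R"
    by (cases rs) (auto simp: program_def L_def enc1_def replicate_add)
  then obtain r where "rep (q, ls, rs) \<leadsto> popping Pr (replicate r Nop @ padl (segments (q * S + ?k))) L ?R"
    using pop_strokes[of 0 "q * S + ?k" "to_nat (Begin :: 'a ins)" L ?R] j by auto
  also have "\<dots> \<leadsto> running (Find (End ?t)) Pr (replicate r Nop @ padl (segments (q * S + ?k))) (enc (tl rs)) ?R"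
    using pop_Cons pop_Nil by (cases rs) (auto simp: L_def)
  also have "\<dots> \<leadsto> running (Find (End ?t)) Pr (padl (segments (q * S + ?k))) (enc (tl rs)) ?R"
    by (rule find_skip) auto
  finally have *: "rep (q, ls, rs) \<leadsto> \<dots>" .
  obtain suf where "running (Find (End ?t)) Pr (padl (segments (q * S + ?k))) (enc (tl rs)) ?R
      \<leadsto> running Ex Pr (padl (action ((q * S + ?k) div S) (dec1 ((q * S + ?k) mod S) ?t)) @ suf) (enc (tl rs)) ?R"
    using find_ending[of ?t "q * S + ?k"] j by (simp add: segments_unfold) blast
  also have "dec1 ((q * S + ?k) mod S) ?t = scanned rs"
    using k by simp
  also have "(q * S + ?k) div S = q"
    using k by simp
  finally show ?thesis using leads_trans[OF *] by blast
qed

lemma rep_step: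
  assumes v: "valid c" and "\<not> halted T c"
  shows "valid (step T c)" and "rep c \<leadsto> rep (step T c)"
proof -
  obtain q ls rs where c: "c = (q, ls, rs)" by (cases c)
  obtain q' x m where l: "fmlookup T (q, scanned rs) = Some (q', x, m)"
    using assms(2) c by auto
  obtain ls' rs' where s: "shift m (ls, x # tl rs) = (ls', rs')" by fastforce
  have st: "step T c = (q', ls', rs')" using c l s by simp
  have sc: "strokes (scanned ls) < S" using v c pos by (cases ls) auto
  have tls: "set (tl ls) \<subseteq> set ls" "set (tl rs) \<subseteq> set rs" by (cases ls; auto) (cases rs; auto)
  \<comment> \<open>A move to the left can expose a blank beyond \<open>ls\<close>, hence
    \<open>scanned ls\<close>.\<close>
  have "set ls' \<union> set rs' \<subseteq> insert x (insert (scanned ls) (set ls \<union> set rs))"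
    using s tls by (cases m) auto
  then show "valid (step T c)" using v c st sc bounds[OF l] by auto
  obtain suf where "rep c \<leadsto> running Ex Pr (padl (action q (scanned rs)) @ suf) (enc (tl rs)) (enc (rev ls))"
    using dispatch v c by blast
  also have "\<dots> = running Ex Pr (padl (write_move x m) @ padl (map PushLeft (replicate (q' * S) Stroke))
      @ padl [Restart] @ suf) (enc (tl rs)) (enc (rev ls))"
    by (simp add: action_def l)
  also have "\<dots> \<leadsto> running Ex Pr (padl (map PushLeft (replicate (q' * S) Stroke))
      @ padl [Restart] @ suf) (enc rs') (enc (rev ls'))"
    by (rule run_write_move) (use s in auto)
  also note run_PushLefts
  also have "running Ex Pr (padl [Restart] @ suf) (rev (replicate (q' * S) Stroke) @ enc rs') (enc (rev ls'))
      \<leadsto> popping Pr (tl Pr) (rev (replicate (q' * S) Stroke) @ enc rs') (enc (rev ls'))"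
  proof -
    have "Begin \<notin> set (tl Pr)"
      using Begin_notin_segments set_padl[of "segments 0"] by (auto simp: program_def)
    then show ?thesis using run_Restart[of Pr "tl Pr"] by (simp add: program_def)
  qed
  finally show "rep c \<leadsto> rep (step T c)" by (simp add: st)
qed

lemma rep_halted:
  assumes "valid c" "halted T c" "d \<in> rep c"
  shows "\<exists>e. reach d e \<and> halted universal (conc e) \<and> output_word (conc e) = output_word c"
proof -
  obtain q ls rs where c: "c = (q, ls, rs)" by (cases c)
  let ?s = "scanned rs"
  let ?L = "End (ending ?s) # enc (tl rs)"
  have l: "fmlookup T (q, ?s) = None" using assms(2) c by simp
  obtain suf where "rep c \<leadsto> running Ex Pr (padl (action q ?s) @ suf) (enc (tl rs)) (enc (rev ls))"
    using dispatch assms(1) c by blast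
  also have "\<dots> = running Ex Pr (padl (map PushLeft [End (ending ?s)]) @ padl [Stop] @ suf)
      (enc (tl rs)) (enc (rev ls))"
    by (simp add: action_def l)
  also note run_PushLefts
  also have "running Ex Pr (padl [Stop] @ suf) (rev [End (ending ?s)] @ enc (tl rs)) (enc (rev ls))
      \<leadsto> {(Halt, ls, map Dat ?L @ prg Pr @ rs) | ls rs. True}"
    using run_Stop[of Pr "replicate (to_nat (Stop :: 'a ins)) Nop @ suf" ?L] by simp
  finally obtain zs ys where e: "reach d (Halt, zs, map Dat ?L @ prg Pr @ ys)"
    using assms(3) unfolding leads_def by blast
  have h: "halted universal (conc (Halt, zs, cs))" for cs
    by (simp add: scanned_map_cell_symbol fmlookup_universal)
  have Pr: "prg Pr @ ys = Ins False Begin # prg (tl Pr) @ ys" by (simp add: program_def)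
  have "takeWhile is_Letter (map cell_symbol (map Dat ?L @ prg Pr @ ys)) = takeWhile is_Letter rs"
  \<comment> \<open>A scanned letter is coded by its ending alone, so \<open>?L = enc rs\<close>.
    Otherwise strokes may be missing from \<open>?L\<close>, but both words are empty.\<close>
  proof (cases "\<exists>a. ?s = Letter a")
    case True
    then obtain a where "?s = Letter a" by blast
    then have "?L = enc rs" by (cases rs) (auto simp: enc1_def)
    then show ?thesis unfolding Pr by (simp only: takeWhile_enc)
  next
    case False
    then have "ending ?s = None" by (cases ?s) auto
    moreover have "takeWhile is_Letter rs = []" using False by (cases rs) (auto simp: is_Letter_def)
    ultimately show ?thesis by simp
  qed
  then have o: "output_word (conc (Halt, zs, map Dat ?L @ prg Pr @ ys)) = output_word c"
    by (simp only: c conc.simps output_word.simps)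
  show ?thesis by (intro exI conjI) (rule e h o)+
qed

lemma result_universal:
  assumes "result T p = Some w"
  shows "result universal (p @ code program) = Some w"
proof -
  let ?i = "(Init, [], lets (p @ code program))"
  let ?start = "lft Pop (lets (rev p)) (Ins True Begin # prg (tl Pr) @ [Blk])"
  \<comment> \<open>Loop invariant for the run of \<open>T\<close>: the universal machine reaches a
    configuration that represents the current one.\<close>
  let ?I = "\<lambda>c. valid c \<and> (\<exists>d\<in>rep c. reach ?i d)"
  from assms obtain c where c: "while_option (\<lambda>c. \<not> halted T c) (step T) (initial p) = Some c"
    and w: "w = output_word c" unfolding result_def by auto
  have "reach ?i ?start"
    using decode_program[OF Begin_notin_segments] by (simp add: program_def)
  moreover have "?start \<in> rep (initial p)"
  proof -
    \<comment> \<open>No explicit blank on the left and one on the right, left over from the turn of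
      \<open>Init\<close>.\<close>
    have "?start = lft Pop (left_tape [] (map (End \<circ> Some) p) 0) (Ins True Begin # right_tape (tl Pr) [] 1)"
      by (simp add: left_tape_def right_tape_def rev_map comp_def)
    also have "\<dots> \<in> popping Pr (tl Pr) (map (End \<circ> Some) p) []"
      by (rule poppingI) (simp add: program_def)
    finally show ?thesis by (simp add: initial_def enc_Letters)
  qed
  moreover have "valid (initial p)" using pos by (auto simp: initial_def)
  ultimately have "?I (initial p)" by blast
  moreover have "?I (step T c)" if "?I c" "\<not> halted T c" for c
  proof -
    from that obtain d e where "d \<in> rep c" "reach ?i d" "e \<in> rep (step T c)" "reach d e"
      using rep_step(2)[of c] unfolding leads_def by blast
    then show ?thesis using that rep_step(1)[of c] reach_trans[of ?i d e] by blast
  qed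
  ultimately have "?I c"
    using while_option_rule[of ?I, OF _ c] by blast
  then obtain d where d: "valid c" "d \<in> rep c" "reach ?i d" by blast
  moreover have "halted T c" using while_option_stop[OF c] by simp
  ultimately obtain e where e: "reach d e" "halted universal (conc e)" "output_word (conc e) = output_word c"
    using rep_halted by blast
  have "conc ?i = initial (p @ code program)"
    by (simp add: initial_def state_number_def)
  then show ?thesis
    using reach_halted[OF reach_trans[OF d(3) e(1)] e(2)] e(3) w by (simp add: result_def)
qed

end

section \<open>Comparison of complexities\<close>

lemma (in two_letters) bounds_exist:
  fixes T :: "'a tm"
  obtains S Q where "compilation a0 a1 T S Q"
proof -
  have "finite (fst ` fset (fmran T))" "finite ((\<lambda>(q, x, m). strokes x) ` fset (fmran T))" by simp_all
  then obtain Q S where "\<forall>n\<in>fst ` fset (fmran T). n < Q"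
    "\<forall>n\<in>(\<lambda>(q, x, m). strokes x) ` fset (fmran T). n < S"
    unfolding finite_nat_set_iff_bounded by metis
  then have "compilation a0 a1 T (Suc S) (Suc Q)"
    by unfold_locales (fastforce dest: fmranI)+
  then show thesis by (rule that)
qed

text \<open>Appending \<open>c\<close> to a shortest input of \<open>T\<close> that solves the
  problem costs \<open>length c\<close>, whatever \<open>P\<close> is.\<close>

lemma problem_complexity_le:
  assumes "\<And>p w. result T p = Some w \<Longrightarrow> result M (p @ c) = Some w"
  shows "problem_complexity P M \<le> problem_complexity P T + enat (length c)"
proof (cases "problem_complexity P T = \<infinity>")
  case False
  let ?A = "{enat (length p) | p w. result T p = Some w \<and> P w}"
  have "?A \<noteq> {}"
    using False unfolding problem_complexity_def by (metis Inf_empty top_enat_def)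
  then have "Inf ?A \<in> ?A" by (metis (no_types, lifting) Inf_enat_def LeastI_ex ex_in_conv)
  then obtain p w where p: "problem_complexity P T = enat (length p)" "result T p = Some w" "P w"
    unfolding problem_complexity_def by blast
  have "problem_complexity P M \<le> enat (length (p @ c))"
    unfolding problem_complexity_def using assms[OF p(2)] p(3) by (intro Inf_lower) blast
  then show ?thesis using p(1) by simp
qed simp

theorem theorem3p1:
  fixes \<P> :: "('a::finite list \<Rightarrow> bool) set"
  assumes "card (UNIV :: 'a set) \<ge> 2"
  shows "\<exists>M :: 'a tm. \<forall>T :: 'a tm. \<exists>k :: nat. \<forall>P\<in>\<P>.
           problem_complexity P M \<le> problem_complexity P T + enat k"
proof -
  obtain a0 a1 :: 'a where "a0 \<noteq> a1"
    using assms by (metis card_2_iff' numeral_2_eq_2 UNIV_I card_le_Suc_iff insertI1 not_numeral_le_zero)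
  then interpret two_letters a0 a1 by unfold_locales
  have "\<exists>k. \<forall>P\<in>\<P>. problem_complexity P universal \<le> problem_complexity P T + enat k" for T :: "'a tm"
  proof -
    obtain S Q where "compilation a0 a1 T S Q" by (rule bounds_exist)
    then interpret compilation a0 a1 T S Q .
    \<comment> \<open>The constant is \<open>length (code program)\<close>, fixed before
      \<open>P\<close> is chosen; \<open>universal\<close> depends on neither \<open>T\<close> nor
      \<open>\<P>\<close>.\<close>
    show ?thesis using problem_complexity_le[OF result_universal] by blast
  qed
  then show ?thesis by blast
qed

end
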